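(* On simply typed $\lambda$-terms, the rewriting systems $\to_a$, $\multimap$, $\to_{\beta_d}$, $\to_\beta$, $\to_h$ and $\multimap_h$ are strongly normalising (there is no infinite reduction sequence starting from a simply typed term).
   Context: Types: $\tau,\sigma::=o\mid\tau\to\sigma$; simply typed terms: variables have fixed types, $\lambda x^\tau.t^\sigma:\tau\to\sigma$, and $s^{\tau\to\sigma}t^\tau:\sigma$. Terms are modulo $\alpha$-conversion with the distinct names convention; $t\{s/x\}$ capture-avoiding substitution; $\mathsf{FV}$ free variables. Contexts have one hole $\square$, plugging without renaming. H-contexts: $H::=\square\mid\lambda x.H\mid H\,t$. E-contexts: $E::=\square\mid E_1[\lambda x.E_2]\,t$. A fresh copy $s'$ of $s$ is an $\alpha$-equivalent copy with all bound variables renamed to new names. Reductions: $\to_\beta$ is $(\lambda x.t)s\to t\{s/x\}$ closed under contexts; $\to_{\beta_d}$ is $E[\lambda x.t]s\to E[t\{s/x\}]$ closed under contexts; $\to_h$ is $\lambda y_1.\ldots\lambda y_k.(\lambda x.t)s\,u_1\ldots u_h\to\lambda y_1.\ldots\lambda y_k.t\{s/x\}u_1\ldots u_h$; $\multimap$ is $E[\lambda x.C[x]]s\multimap E[\lambda x.C[s']]s$ ($C$ a context whose hole is an occurrence of $x$ bound by the displayed $\lambda x$, $s'$ a fresh copy of $s$) closed under contexts; $\to_g$ is $E[\lambda x.t]s\to E[t]$ when $x\notin\mathsf{FV}(t)$, closed under contexts; $\to_a=\multimap\cup\to_g$; $\multimap_h$ is the rule $E[\lambda x.H[x]]s\multimap_h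 E[\lambda x.H[s']]s$ ($H$ an H-context with $x$ in its hole) closed under H-contexts. *)

theory Defs
  imports Main
begin

datatype ty = Base | Arr ty ty

(* Terms modulo alpha-conversion are represented by de Bruijn indices. *)
datatype tm = Var nat | Lam ty tm | App tm tm

(* The typing environment gives every free variable its fixed type; Lam A carries the
   type of the variable it binds. *)
inductive has_type :: "(nat \<Rightarrow> ty) \<Rightarrow> tm \<Rightarrow> ty \<Rightarrow> bool" where
  "has_type \<Gamma> (Var i) (\<Gamma> i)"
| "has_type (case_nat A \<Gamma>) t B \<Longrightarrow> has_type \<Gamma> (Lam A t) (Arr A B)"
| "has_type \<Gamma> t (Arr A B) \<Longrightarrow> has_type \<Gamma> s A \<Longrightarrow> has_type \<Gamma> (App t s) B"

primrec FV :: "tm \<Rightarrow> nat set" where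
  "FV (Var i) = {i}"
| "FV (Lam A t) = {i. Suc i \<in> FV t}"
| "FV (App t s) = FV t \<union> FV s"

primrec rename :: "(nat \<Rightarrow> nat) \<Rightarrow> tm \<Rightarrow> tm" where
  "rename f (Var i) = Var (f i)"
| "rename f (Lam A t) = Lam A (rename (case_nat 0 (\<lambda>i. Suc (f i))) t)"
| "rename f (App t s) = App (rename f t) (rename f s)"

(* The same term, moved below n further binders. *)
definition shift :: "nat \<Rightarrow> tm \<Rightarrow> tm" where
  "shift n = rename (\<lambda>i. i + n)"

(* The same term, with the binder of index 0 removed; meaningful only if 0 \<notin> FV t. *)
definition unshift :: "tm \<Rightarrow> tm" where
  "unshift = rename (\<lambda>i. i - 1)"

primrec psubst :: "(nat \<Rightarrow> tm) \<Rightarrow> tm \<Rightarrow> tm" where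
  "psubst \<sigma> (Var i) = \<sigma> i"
| "psubst \<sigma> (Lam A t) = Lam A (psubst (case_nat (Var 0) (\<lambda>i. shift 1 (\<sigma> i))) t)"
| "psubst \<sigma> (App t s) = App (psubst \<sigma> t) (psubst \<sigma> s)"

(* t{s/x} for the body t of \<lambda>x.t: index 0 becomes s, the other indices drop by one. *)
definition subst :: "tm \<Rightarrow> tm \<Rightarrow> tm" where
  "subst t s = psubst (case_nat s Var) t"

datatype ctx = Hole | CLam ty ctx | CAppL ctx tm | CAppR tm ctx

(* Binders of the context capture: the plugged term is not shifted. *)
primrec plug :: "ctx \<Rightarrow> tm \<Rightarrow> tm" where
  "plug Hole t = t"
| "plug (CLam A C) t = Lam A (plug C t)"
| "plug (CAppL C s) t = App (plug C t) s"
| "plug (CAppR s C) t = App s (plug C t)"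

primrec plug_ctx :: "ctx \<Rightarrow> ctx \<Rightarrow> ctx" where
  "plug_ctx Hole D = D"
| "plug_ctx (CLam A C) D = CLam A (plug_ctx C D)"
| "plug_ctx (CAppL C s) D = CAppL (plug_ctx C D) s"
| "plug_ctx (CAppR s C) D = CAppR s (plug_ctx C D)"

(* Number of binders above the hole. *)
primrec depth :: "ctx \<Rightarrow> nat" where
  "depth Hole = 0"
| "depth (CLam A C) = Suc (depth C)"
| "depth (CAppL C s) = depth C"
| "depth (CAppR s C) = depth C"

inductive Hctx :: "ctx \<Rightarrow> bool" where
  "Hctx Hole"
| "Hctx H \<Longrightarrow> Hctx (CLam A H)"
| "Hctx H \<Longrightarrow> Hctx (CAppL H t)"

inductive Ectx :: "ctx \<Rightarrow> bool" where
  "Ectx Hole"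
| "Ectx E1 \<Longrightarrow> Ectx E2 \<Longrightarrow> Ectx (CAppL (plug_ctx E1 (CLam A E2)) t)"

(* One use of the rule R in the hole of a context from the class K. *)
inductive ctx_closure :: "(ctx \<Rightarrow> bool) \<Rightarrow> (tm \<Rightarrow> tm \<Rightarrow> bool) \<Rightarrow> tm \<Rightarrow> tm \<Rightarrow> bool"
  for K :: "ctx \<Rightarrow> bool" and R :: "tm \<Rightarrow> tm \<Rightarrow> bool" where
  "K C \<Longrightarrow> R t u \<Longrightarrow> ctx_closure K R (plug C t) (plug C u)"

abbreviation any_closure :: "(tm \<Rightarrow> tm \<Rightarrow> bool) \<Rightarrow> tm \<Rightarrow> tm \<Rightarrow> bool" where
  "any_closure \<equiv> ctx_closure (\<lambda>_. True)"

inductive beta_root :: "tm \<Rightarrow> tm \<Rightarrow> bool" where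
  "beta_root (App (Lam A t) s) (subst t s)"

(* The argument s moves below the binders of E, hence the shift. *)
inductive betad_root :: "tm \<Rightarrow> tm \<Rightarrow> bool" where
  "Ectx E \<Longrightarrow>
   betad_root (App (plug E (Lam A t)) s) (plug E (subst t (shift (depth E) s)))"

(* Var (depth C) in the hole of C is an occurrence of the variable bound just above C.
   The copy of s moves below the binders of E, the displayed binder and those of C;
   renaming its bound variables is vacuous for de Bruijn terms. *)
inductive lin_root :: "(ctx \<Rightarrow> bool) \<Rightarrow> tm \<Rightarrow> tm \<Rightarrow> bool" for K :: "ctx \<Rightarrow> bool" where
  "Ectx E \<Longrightarrow> K C \<Longrightarrow>
   lin_root K (App (plug E (Lam A (plug C (Var (depth C))))) s)
              (App (plug E (Lam A (plug C (shift (depth E + 1 + depth C) s)))) s)"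

inductive gc_root :: "tm \<Rightarrow> tm \<Rightarrow> bool" where
  "Ectx E \<Longrightarrow> 0 \<notin> FV t \<Longrightarrow>
   gc_root (App (plug E (Lam A t)) s) (plug E (unshift t))"

definition red_beta :: "tm \<Rightarrow> tm \<Rightarrow> bool" where
  "red_beta = any_closure beta_root"

definition red_betad :: "tm \<Rightarrow> tm \<Rightarrow> bool" where
  "red_betad = any_closure betad_root"

inductive red_head :: "tm \<Rightarrow> tm \<Rightarrow> bool" where
  "red_head (foldr Lam As (foldl App (App (Lam A t) s) us))
            (foldr Lam As (foldl App (subst t s) us))"

definition red_lin :: "tm \<Rightarrow> tm \<Rightarrow> bool" where
  "red_lin = any_closure (lin_root (\<lambda>_. True))"

definition red_gc :: "tm \<Rightarrow> tm \<Rightarrow> bool" where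
  "red_gc = any_closure gc_root"

definition red_a :: "tm \<Rightarrow> tm \<Rightarrow> bool" where
  "red_a t u \<longleftrightarrow> red_lin t u \<or> red_gc t u"

definition red_lin_head :: "tm \<Rightarrow> tm \<Rightarrow> bool" where
  "red_lin_head = ctx_closure Hctx (lin_root Hctx)"

definition SN_at :: "(tm \<Rightarrow> tm \<Rightarrow> bool) \<Rightarrow> tm \<Rightarrow> bool" where
  "SN_at R t \<longleftrightarrow> \<not> (\<exists>f :: nat \<Rightarrow> tm. f 0 = t \<and> (\<forall>i. R (f i) (f (Suc i))))"

definition strongly_normalising :: "(tm \<Rightarrow> tm \<Rightarrow> bool) \<Rightarrow> bool" where
  "strongly_normalising R \<longleftrightarrow> (\<forall>\<Gamma> t \<tau>. has_type \<Gamma> t \<tau> \<longrightarrow> SN_at R t)"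

end

theory Submission
  imports Defs "HOL-Library.Multiset" "HOL-Library.Function_Algebras"
begin

text \<open>Terms are typed by points of the multiset-based relational model, that is, by non-idempotent
  intersection types with weakening at the axioms, except that every argument carries one
  derivation more than its function asks for. Linear substitution replaces the axioms of one
  occurrence of the variable by derivations taken from the argument, and the extra derivation keeps
  the remaining copy of the argument typed; garbage collection discards that extra derivation. So
  the number of axioms decreases in every step, and it remains to type all simply typed terms. This
  follows from a totality argument in the model that involves no reduction at all: the interpretation
  of a term of type \<open>A\<close> is total at \<open>A\<close>, and total sets are nonempty.\<close>

section \<open>Points, bags and counted derivations\<close>

datatype point = Star | Fn "point multiset" point

(* This rule would unfold the eta-expanded sums of environments that induction leaves in goals. *)
declare plus_fun_apply [simp del]

type_synonym env = "nat \<Rightarrow> point multiset"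

text \<open>Parametric in \<open>P\<close> so that \<open>derives\<close> can recurse structurally
  into the argument of an application. An empty bag accepts every environment, so weakening is built
  in here as well as at variables.\<close>

inductive bag :: "(env \<Rightarrow> point \<Rightarrow> nat \<Rightarrow> bool) \<Rightarrow> env \<Rightarrow> point multiset \<Rightarrow> nat \<Rightarrow> bool"
  for P :: "env \<Rightarrow> point \<Rightarrow> nat \<Rightarrow> bool" where
  empty: "bag P \<Gamma> {#} 0"
| add: "P \<Gamma> a n \<Longrightarrow> bag P \<Delta> M m \<Longrightarrow> bag P (\<Gamma> + \<Delta>) (add_mset a M) (n + m)"

text \<open>The number \<open>n\<close> counts axioms, and \<open>w\<close> is the point of the extra derivation of the argument.\<close>
primrec derives :: "tm \<Rightarrow> env \<Rightarrow> point \<Rightarrow> nat \<Rightarrow> bool" where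
  "derives (Var i) = (\<lambda>\<Gamma> a n. a \<in># \<Gamma> i \<and> n = 1)"
| "derives (Lam A t) = (\<lambda>\<Gamma> a n. \<exists>M b. a = Fn M b \<and> derives t (case_nat M \<Gamma>) b n)"
| "derives (App t s) = (\<lambda>\<Gamma> a n. \<exists>\<Gamma>1 \<Gamma>2 M w n1 n2. \<Gamma> = \<Gamma>1 + \<Gamma>2 \<and> n = n1 + n2 \<and>
     derives t \<Gamma>1 (Fn M a) n1 \<and> bag (derives s) \<Gamma>2 (add_mset w M) n2)"

lemma derives_App:
  "derives t \<Gamma> (Fn M a) n \<Longrightarrow> bag (derives s) \<Delta> (add_mset w M) m \<Longrightarrow>
    derives (App t s) (\<Gamma> + \<Delta>) a (n + m)"
  unfolding derives.simps by blast

lemma bag_empty_iff [simp]: "bag P \<Gamma> {#} n \<longleftrightarrow> n = 0"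
  by (auto intro: bag.empty elim: bag.cases)

lemma bag_singleD:
  assumes "bag P \<Gamma> {#a#} n"
  shows "\<exists>\<Gamma>1 \<Gamma>2. \<Gamma> = \<Gamma>1 + \<Gamma>2 \<and> P \<Gamma>1 a n"
  using assms by (cases rule: bag.cases) auto

text \<open>The derivation of each element goes to a side that holds this element. Substitution
  distributes the derivations of an argument in this way.\<close>

lemma bag_split:
  assumes "bag P \<Gamma> (K + L) n"
  shows "\<exists>\<Gamma>1 \<Gamma>2 n1 n2. \<Gamma> = \<Gamma>1 + \<Gamma>2 \<and> n = n1 + n2 \<and> bag P \<Gamma>1 K n1 \<and> bag P \<Gamma>2 L n2"
  using assms
proof (induction \<Gamma> "K + L" n arbitrary: K L)
  case (empty \<Gamma>)
  then have "K = {#}" "L = {#}" by auto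
  moreover have "\<Gamma> = \<Gamma> + 0" by simp
  ultimately show ?case by (metis add_0 bag.empty)
next
  case (add \<Gamma> a n \<Delta> M m)
  then have "a \<in># K \<or> a \<in># L"
    by (metis union_iff union_single_eq_member)
  then show ?case
  proof
    assume "a \<in># K"
    then obtain K' where K: "K = add_mset a K'" by (metis mset_add)
    with add(4) have "M = K' + L" by simp
    from add(3)[OF this] obtain \<Gamma>1 \<Gamma>2 n1 n2 where
      "\<Delta> = \<Gamma>1 + \<Gamma>2" "m = n1 + n2" "bag P \<Gamma>1 K' n1" "bag P \<Gamma>2 L n2" by blast
    moreover from this have "bag P (\<Gamma> + \<Gamma>1) K (n + n1)" using K add(1) bag.add by metis
    ultimately show ?thesis by (metis add.assoc)
  next
    assume "a \<in># L"
    then obtain L' where L: "L = add_mset a L'" by (metis mset_add)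
    with add(4) have "M = K + L'" by simp
    from add(3)[OF this] obtain \<Gamma>1 \<Gamma>2 n1 n2 where
      "\<Delta> = \<Gamma>1 + \<Gamma>2" "m = n1 + n2" "bag P \<Gamma>1 K n1" "bag P \<Gamma>2 L' n2" by blast
    moreover from this have "bag P (\<Gamma> + \<Gamma>2) L (n + n2)" using L add(1) bag.add by metis
    ultimately show ?thesis by (metis add.left_commute)
  qed
qed

lemma bag_map:
  assumes "bag P \<Gamma> M n"
    and "\<And>\<Gamma> a n. P \<Gamma> a n \<Longrightarrow> Q (f \<Gamma>) a n"
    and "\<And>\<Gamma> \<Delta>. f (\<Gamma> + \<Delta>) = f \<Gamma> + f \<Delta>"
  shows "bag Q (f \<Gamma>) M n"
  using assms(1)
proof induction
  case (add \<Gamma> a n \<Delta> M m)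
  then show ?case unfolding assms(3) by (intro bag.add assms(2))
qed (rule bag.empty)

text \<open>A drop of at least one per element adds up to \<open>size M\<close>. The induction
  proves this stronger bound because the tail of the bag may be empty.\<close>

lemma bag_less:
  assumes "bag P \<Gamma> M n" "M \<noteq> {#}" and "\<And>\<Gamma> a n. P \<Gamma> a n \<Longrightarrow> \<exists>m<n. Q \<Gamma> a m"
  shows "\<exists>m<n. bag Q \<Gamma> M m"
proof -
  have "\<exists>m. m + size M \<le> n \<and> bag Q \<Gamma> M m"
    using assms(1)
  proof induction
    case (add \<Gamma> a n \<Delta> M m)
    then obtain k l where "k < n" "Q \<Gamma> a k" "l + size M \<le> m" "bag Q \<Delta> M l"
      using assms(3) by blast
    then show ?case by (intro exI[of _ "k + l"]) (auto intro: bag.add)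
  qed (auto intro: bag.empty)
  moreover have "0 < size M" using assms(2) by (simp add: nonempty_has_size)
  ultimately show ?thesis by (metis less_add_same_cancel1 less_le_trans)
qed

section \<open>Weakening, renaming and shifting of derivations\<close>

lemma case_nat_plus: "case_nat (M + N) (\<Gamma> + \<Delta>) = case_nat M \<Gamma> + case_nat N (\<Delta> :: env)"
  by (rule ext) (simp add: plus_fun_apply split: nat.split)

text \<open>Extra points cost no axiom: the frame enters the function part of an application and
  gets an empty bag at each binder that it crosses.\<close>

lemma derives_weaken: "derives t \<Gamma> a n \<Longrightarrow> derives t (\<Gamma> + \<Delta>) a n"
proof (induction t arbitrary: \<Gamma> \<Delta> a n)
  case (Lam A t)
  then obtain M b where M: "a = Fn M b" "derives t (case_nat M \<Gamma>) b n" by auto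
  from Lam.IH[OF M(2), of "case_nat {#} \<Delta>"] show ?case
    using M(1) by (simp flip: case_nat_plus)
next
  case (App t s)
  then obtain \<Gamma>1 \<Gamma>2 M w n1 n2 where *: "\<Gamma> = \<Gamma>1 + \<Gamma>2" "n = n1 + n2"
    "derives t \<Gamma>1 (Fn M a) n1" "bag (derives s) \<Gamma>2 (add_mset w M) n2" by auto
  have "derives (App t s) ((\<Gamma>1 + \<Delta>) + \<Gamma>2) a (n1 + n2)"
    using App.IH(1)[OF *(3)] *(4) by (rule derives_App)
  then show ?case using *(1,2) by (simp add: ac_simps del: derives.simps)
qed (simp add: plus_fun_apply)

lemma derives_pos: "derives t \<Gamma> a n \<Longrightarrow> 0 < n"
proof (induction t arbitrary: \<Gamma> a n)
  case (App t s)
  then show ?case by fastforce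
qed auto

lemma bag_pos: "bag (derives t) \<Gamma> M n \<Longrightarrow> M \<noteq> {#} \<Longrightarrow> 0 < n"
  by (induction rule: bag.cases) (auto dest: derives_pos)

definition pull :: "(nat \<Rightarrow> nat option) \<Rightarrow> env \<Rightarrow> env" where
  "pull h \<Gamma> j = (case h j of None \<Rightarrow> {#} | Some i \<Rightarrow> \<Gamma> i)"

lemma pull_plus: "pull h (\<Gamma> + \<Delta>) = pull h \<Gamma> + pull h \<Delta>"
  by (rule ext) (simp add: pull_def plus_fun_apply split: option.split)

text \<open>The partial map \<open>h\<close> reads indices backwards. It has to invert
  \<open>f\<close> on the free variables only, so that the non-injective renaming behind
  \<open>unshift\<close> is covered as well as shifts.\<close>

lemma derives_rename:
  assumes "derives t \<Gamma> a n" and "\<And>i. i \<in> FV t \<Longrightarrow> h (f i) = Some i"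
  shows "derives (rename f t) (pull h \<Gamma>) a n"
  using assms
proof (induction t arbitrary: \<Gamma> a n h f)
  case (Var i)
  then show ?case by (simp add: pull_def)
next
  case (Lam A t)
  then obtain M b where M: "a = Fn M b" "derives t (case_nat M \<Gamma>) b n" by auto
  let ?h = "case_nat (Some 0) (\<lambda>i. map_option Suc (h i))"
  have "derives (rename (case_nat 0 (\<lambda>i. Suc (f i))) t) (pull ?h (case_nat M \<Gamma>)) b n"
    using M(2) Lam.prems(2) by (intro Lam.IH) (auto split: nat.split)
  moreover have "pull ?h (case_nat M \<Gamma>) = case_nat M (pull h \<Gamma>)"
    by (rule ext) (simp add: pull_def split: nat.split option.split)
  ultimately show ?case using M(1) by simp
next
  case (App t s)
  then obtain \<Gamma>1 \<Gamma>2 M w n1 n2 where *: "\<Gamma> = \<Gamma>1 + \<Gamma>2" "n = n1 + n2"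
    "derives t \<Gamma>1 (Fn M a) n1" "bag (derives s) \<Gamma>2 (add_mset w M) n2" by auto
  have "derives (rename f t) (pull h \<Gamma>1) (Fn M a) n1"
    using *(3) App by simp
  moreover have "bag (derives (rename f s)) (pull h \<Gamma>2) (add_mset w M) n2"
    using *(4) by (rule bag_map) (use App in \<open>auto simp: pull_plus\<close>)
  ultimately have "derives (rename f (App t s)) (pull h \<Gamma>1 + pull h \<Gamma>2) a (n1 + n2)"
    unfolding rename.simps by (rule derives_App)
  then show ?case using *(1,2) by (simp add: pull_plus del: derives.simps)
qed

definition shift_env :: "nat \<Rightarrow> env \<Rightarrow> env" where
  "shift_env d \<Gamma> j = (if j < d then {#} else \<Gamma> (j - d))"

lemma shift_env_plus: "shift_env d (\<Gamma> + \<Delta>) = shift_env d \<Gamma> + shift_env d \<Delta>"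
  by (rule ext) (simp add: shift_env_def plus_fun_apply)

lemma shift_env_Suc: "shift_env (Suc d) \<Gamma> = case_nat {#} (shift_env d \<Gamma>)"
  by (rule ext) (simp add: shift_env_def split: nat.split)

lemma shift_env_shift_env: "shift_env d (shift_env e \<Gamma>) = shift_env (e + d) \<Gamma>"
  by (rule ext) (auto simp: shift_env_def add.commute)

lemma shift_env_0 [simp]: "shift_env 0 \<Gamma> = \<Gamma>"
  by (rule ext) (simp add: shift_env_def)

lemma derives_shift: "derives t \<Gamma> a n \<Longrightarrow> derives (shift d t) (shift_env d \<Gamma>) a n"
proof -
  assume "derives t \<Gamma> a n"
  moreover have "shift_env d \<Gamma> = pull (\<lambda>j. if j < d then None else Some (j - d)) \<Gamma>"
    by (rule ext) (simp add: shift_env_def pull_def)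
  ultimately show ?thesis unfolding shift_def by (auto intro: derives_rename)
qed

lemma bag_shift: "bag (derives t) \<Gamma> M n \<Longrightarrow> bag (derives (shift d t)) (shift_env d \<Gamma>) M n"
  by (erule bag_map) (auto intro: derives_shift shift_env_plus)

lemma derives_unshift:
  assumes "derives t (case_nat M \<Gamma>) a n" "0 \<notin> FV t"
  shows "derives (unshift t) \<Gamma> a n"
proof -
  have "pull (\<lambda>j. Some (Suc j)) (case_nat M \<Gamma>) = \<Gamma>"
    by (rule ext) (simp add: pull_def)
  moreover have "Suc (i - 1) = i" if "i \<in> FV t" for i
    using that assms(2) by (cases i) auto
  ultimately show ?thesis
    using derives_rename[OF assms(1), of "\<lambda>j. Some (Suc j)" "\<lambda>i. i - 1"]
    by (simp add: unshift_def)
qed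

lemma rename_rename: "rename f (rename g t) = rename (\<lambda>i. f (g i)) t"
proof (induction t arbitrary: f g)
  case (Lam A t)
  have "case_nat 0 (\<lambda>i. Suc (f i)) (case_nat 0 (\<lambda>i. Suc (g i)) i)
      = case_nat 0 (\<lambda>i. Suc (f (g i))) i" for i
    by (simp split: nat.split)
  then show ?case by (simp add: Lam)
qed auto

lemma rename_id: "rename (\<lambda>i. i) t = t"
proof (induction t)
  case (Lam A t)
  have "case_nat 0 (\<lambda>i. Suc i) = (\<lambda>i. i)"
    by (rule ext) (simp add: plus_fun_apply split: nat.split)
  then show ?case using Lam by simp
qed auto

lemma shift_shift: "shift d (shift e t) = shift (e + d) t"
  by (simp add: shift_def rename_rename add.assoc)

lemma shift_0 [simp]: "shift 0 t = t"
  by (simp add: shift_def rename_id)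

section \<open>Plugging and the typing of E-contexts\<close>

lemma plug_plug_ctx: "plug (plug_ctx C D) t = plug C (plug D t)"
  by (induction C) auto

lemma depth_plug_ctx: "depth (plug_ctx C D) = depth C + depth D"
  by (induction C) auto

text \<open>An E-context uses the term in its hole exactly once and at its own point, so that typing it
  amounts to a relation between the environments outside and inside; a frame \<open>\<Delta>\<close> can be carried
  from outside to inside.\<close>
lemma Ectx_derives:
  assumes "Ectx E"
  obtains R where
    "\<And>t \<Gamma> a n. derives (plug E t) \<Gamma> a n \<longleftrightarrow> (\<exists>\<Gamma>' k m. R \<Gamma> \<Gamma>' k \<and> derives t \<Gamma>' a m \<and> n = k + m)"
    "\<And>\<Gamma> \<Gamma>' k \<Delta>. R \<Gamma> \<Gamma>' k \<Longrightarrow> R (\<Gamma> + \<Delta>) (\<Gamma>' + shift_env (depth E) \<Delta>) (k::nat)"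
  using assms
proof (induction arbitrary: thesis)
  case 1
  show ?case
    by (rule 1[of "\<lambda>\<Gamma> \<Gamma>' k. \<Gamma>' = \<Gamma> \<and> k = 0"]) auto
next
  case (2 E1 E2 A s)
  obtain R1 where R1:
    "\<And>t \<Gamma> a n. derives (plug E1 t) \<Gamma> a n \<longleftrightarrow> (\<exists>\<Gamma>' k m. R1 \<Gamma> \<Gamma>' k \<and> derives t \<Gamma>' a m \<and> n = k + m)"
    "\<And>\<Gamma> \<Gamma>' k \<Delta>. R1 \<Gamma> \<Gamma>' k \<Longrightarrow> R1 (\<Gamma> + \<Delta>) (\<Gamma>' + shift_env (depth E1) \<Delta>) k"
    using "2.IH"(1) by blast
  obtain R2 where R2:
    "\<And>t \<Gamma> a n. derives (plug E2 t) \<Gamma> a n \<longleftrightarrow> (\<exists>\<Gamma>' k m. R2 \<Gamma> \<Gamma>' k \<and> derives t \<Gamma>' a m \<and> n = k + m)"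
    "\<And>\<Gamma> \<Gamma>' k \<Delta>. R2 \<Gamma> \<Gamma>' k \<Longrightarrow> R2 (\<Gamma> + \<Delta>) (\<Gamma>' + shift_env (depth E2) \<Delta>) k"
    using "2.IH"(2) by blast
  \<comment> \<open>The two relations compose across the redex: the binder between \<open>E1\<close>
    and \<open>E2\<close> adds \<open>M\<close>, which is the bag of \<open>s\<close> without
    \<open>w\<close>, and the axioms used for \<open>s\<close> go into \<open>k3\<close>.\<close>
  define R where "R \<Gamma> \<Gamma>' k \<longleftrightarrow> (\<exists>\<Gamma>1 \<Gamma>2 \<Gamma>3 M w k1 k2 k3. \<Gamma> = \<Gamma>1 + \<Gamma>2 \<and> k = k1 + k2 + k3 \<and>
    R1 \<Gamma>1 \<Gamma>3 k1 \<and> R2 (case_nat M \<Gamma>3) \<Gamma>' k2 \<and> bag (derives s) \<Gamma>2 (add_mset w M) k3)"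
    for \<Gamma> \<Gamma>' k
  show ?case
  proof (rule "2.prems"[of R])
    fix t \<Gamma> a n
    show "derives (plug (CAppL (plug_ctx E1 (CLam A E2)) s) t) \<Gamma> a n \<longleftrightarrow>
      (\<exists>\<Gamma>' k m. R \<Gamma> \<Gamma>' k \<and> derives t \<Gamma>' a m \<and> n = k + m)" (is "?l \<longleftrightarrow> ?r")
    proof
      assume ?l
      then obtain \<Gamma>1 \<Gamma>2 M w n1 n2 where "\<Gamma> = \<Gamma>1 + \<Gamma>2" "n = n1 + n2"
        "derives (plug E1 (Lam A (plug E2 t))) \<Gamma>1 (Fn M a) n1"
        "bag (derives s) \<Gamma>2 (add_mset w M) n2"
        by (auto simp: plug_plug_ctx)
      moreover from this(3) obtain \<Gamma>3 k m where "R1 \<Gamma>1 \<Gamma>3 k" "n1 = k + m"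
        "derives (plug E2 t) (case_nat M \<Gamma>3) a m"
        by (auto simp: R1(1))
      moreover from this(3) obtain \<Gamma>' k' m' where "R2 (case_nat M \<Gamma>3) \<Gamma>' k'" "m = k' + m'"
        "derives t \<Gamma>' a m'"
        by (auto simp: R2(1))
      ultimately have "R \<Gamma> \<Gamma>' (k + k' + n2) \<and> derives t \<Gamma>' a m' \<and> n = k + k' + n2 + m'"
        unfolding R_def by (intro conjI exI[of _ \<Gamma>1] exI[of _ \<Gamma>2] exI[of _ \<Gamma>3] exI[of _ M]
          exI[of _ w] exI[of _ k] exI[of _ k'] exI[of _ n2]) auto
      then show ?r by blast
    next
      assume ?r
      then obtain \<Gamma>' \<Gamma>1 \<Gamma>2 \<Gamma>3 M w k1 k2 k3 m where *: "\<Gamma> = \<Gamma>1 + \<Gamma>2" "n = k1 + k2 + k3 + m"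
        "R1 \<Gamma>1 \<Gamma>3 k1" "R2 (case_nat M \<Gamma>3) \<Gamma>' k2" "bag (derives s) \<Gamma>2 (add_mset w M) k3"
        "derives t \<Gamma>' a m" unfolding R_def by auto
      then have "derives (plug E2 t) (case_nat M \<Gamma>3) a (k2 + m)" using R2(1) by blast
      then have "derives (Lam A (plug E2 t)) \<Gamma>3 (Fn M a) (k2 + m)" by simp
      then have "derives (plug E1 (Lam A (plug E2 t))) \<Gamma>1 (Fn M a) (k1 + (k2 + m))"
        using R1(1) *(3) by blast
      moreover have "n = (k1 + (k2 + m)) + k3" using *(2) by simp
      ultimately show ?l using *(1,5) by (simp add: plug_plug_ctx) blast
    qed
  next
    fix \<Gamma> \<Gamma>' k \<Delta>
    assume "R \<Gamma> \<Gamma>' k"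
    then obtain \<Gamma>1 \<Gamma>2 \<Gamma>3 M w k1 k2 k3 where *: "\<Gamma> = \<Gamma>1 + \<Gamma>2" "k = k1 + k2 + k3"
      "R1 \<Gamma>1 \<Gamma>3 k1" "R2 (case_nat M \<Gamma>3) \<Gamma>' k2" "bag (derives s) \<Gamma>2 (add_mset w M) k3"
      unfolding R_def by auto
    \<comment> \<open>The frame goes through \<open>E1\<close> and \<open>E2\<close> and never into
      \<open>s\<close>. It gets an empty bag at the binder between them, hence one more
      shift.\<close>
    let ?D = "shift_env (depth E1) \<Delta>"
    have "R1 (\<Gamma>1 + \<Delta>) (\<Gamma>3 + ?D) k1" using R1(2) *(3) by blast
    moreover have "R2 (case_nat M (\<Gamma>3 + ?D))
        (\<Gamma>' + shift_env (depth (CAppL (plug_ctx E1 (CLam A E2)) s)) \<Delta>) k2"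
      using R2(2)[OF *(4), of "case_nat {#} ?D"] case_nat_plus[of M "{#}" \<Gamma>3 ?D]
      by (simp add: depth_plug_ctx shift_env_shift_env flip: shift_env_Suc)
    moreover have "\<Gamma> + \<Delta> = (\<Gamma>1 + \<Delta>) + \<Gamma>2" using *(1) by (simp add: ac_simps)
    ultimately show "R (\<Gamma> + \<Delta>) (\<Gamma>' + shift_env (depth (CAppL (plug_ctx E1 (CLam A E2)) s)) \<Delta>) k"
      unfolding R_def using *(2,5) by blast
  qed
qed

section \<open>Decrease of the axiom count; garbage collection\<close>

text \<open>Environment and point are kept so that the surrounding derivation can be rebuilt. Both
  are quantified because a hole in an argument may be typed several times in different ways.\<close>

definition decreases :: "tm \<Rightarrow> tm \<Rightarrow> bool" where
  "decreases t u \<longleftrightarrow> (\<forall>\<Gamma> a n. derives t \<Gamma> a n \<longrightarrow> (\<exists>m<n. derives u \<Gamma> a m))"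

text \<open>The delicate position is an argument, whose hole is typed once per element of
  \<open>add_mset w M\<close>. All these derivations shrink, and \<open>w\<close> guarantees that
  there is at least one.\<close>

lemma decreases_plug: "decreases t u \<Longrightarrow> decreases (plug C t) (plug C u)"
proof (induction C)
  case (CLam A C)
  then show ?case by (fastforce simp: decreases_def)
next
  case (CAppL C s)
  then have IH: "decreases (plug C t) (plug C u)" by blast
  show ?case unfolding decreases_def
  proof (intro allI impI)
    fix \<Gamma> a n
    assume "derives (plug (CAppL C s) t) \<Gamma> a n"
    then obtain \<Gamma>1 \<Gamma>2 M w n1 n2 where *: "\<Gamma> = \<Gamma>1 + \<Gamma>2" "n = n1 + n2"
      "derives (plug C t) \<Gamma>1 (Fn M a) n1" "bag (derives s) \<Gamma>2 (add_mset w M) n2" by auto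
    with IH obtain m where "m < n1" "derives (plug C u) \<Gamma>1 (Fn M a) m"
      unfolding decreases_def by blast
    moreover from derives_App[OF this(2) *(4)]
    have "derives (plug (CAppL C s) u) \<Gamma> a (m + n2)" unfolding *(1) plug.simps .
    ultimately show "\<exists>m<n. derives (plug (CAppL C s) u) \<Gamma> a m"
      using *(2) by (metis add_less_mono1)
  qed
next
  case (CAppR s C)
  then have IH: "decreases (plug C t) (plug C u)" by blast
  show ?case unfolding decreases_def
  proof (intro allI impI)
    fix \<Gamma> a n
    assume "derives (plug (CAppR s C) t) \<Gamma> a n"
    then obtain \<Gamma>1 \<Gamma>2 M w n1 n2 where *: "\<Gamma> = \<Gamma>1 + \<Gamma>2" "n = n1 + n2"
      "derives s \<Gamma>1 (Fn M a) n1" "bag (derives (plug C t)) \<Gamma>2 (add_mset w M) n2" by auto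
    then obtain m where "m < n2" "bag (derives (plug C u)) \<Gamma>2 (add_mset w M) m"
      using IH unfolding decreases_def by (metis bag_less add_mset_not_empty)
    moreover from derives_App[OF *(3) this(2)]
    have "derives (plug (CAppR s C) u) \<Gamma> a (n1 + m)" unfolding *(1) plug.simps .
    ultimately show "\<exists>m<n. derives (plug (CAppR s C) u) \<Gamma> a m"
      using *(2) by (metis add_less_cancel_left)
  qed
qed simp

lemma decreases_ctx_closure:
  assumes "ctx_closure K R t u" and "\<And>t u. R t u \<Longrightarrow> decreases t u"
  shows "decreases t u"
  using assms(1) by cases (auto intro: decreases_plug assms(2))

text \<open>All derivations of the argument are dropped. Their count is positive thanks to
  \<open>w\<close>, and weakening restores their environment.\<close>

lemma decreases_gc_root: "gc_root t u \<Longrightarrow> decreases t u"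
proof (induction rule: gc_root.induct)
  case (1 E t A s)
  obtain R where R:
    "\<And>t \<Gamma> a n. derives (plug E t) \<Gamma> a n \<longleftrightarrow> (\<exists>\<Gamma>' k m. R \<Gamma> \<Gamma>' k \<and> derives t \<Gamma>' a m \<and> n = k + m)"
    using Ectx_derives[OF 1(1)] by metis
  show ?case unfolding decreases_def
  proof (intro allI impI)
    fix \<Gamma> a n
    assume "derives (App (plug E (Lam A t)) s) \<Gamma> a n"
    then obtain \<Gamma>1 \<Gamma>2 M w k m n2 \<Gamma>' where *: "\<Gamma> = \<Gamma>1 + \<Gamma>2" "n = k + m + n2" "R \<Gamma>1 \<Gamma>' k"
      "derives t (case_nat M \<Gamma>') a m" "bag (derives s) \<Gamma>2 (add_mset w M) n2" by (auto simp: R)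
    then have "derives (plug E (unshift t)) \<Gamma>1 a (k + m)"
      using R derives_unshift 1(2) by blast
    with * bag_pos[OF *(5)] show "\<exists>m<n. derives (plug E (unshift t)) \<Gamma> a m"
      by (intro exI[of _ "k + m"]) (auto intro: derives_weaken)
  qed
qed

section \<open>Full substitution\<close>

definition subst_at :: "nat \<Rightarrow> tm \<Rightarrow> nat \<Rightarrow> tm" where
  "subst_at x s i = (if i < x then Var i else if i = x then s else Var (i - 1))"

text \<open>Axioms for \<open>x\<close> are replaced by derivations from the bag; elements left over
  are dropped, so there is only an upper bound. The index \<open>x\<close> is arbitrary to let the
  induction pass below binders, and the resulting environment skips it.\<close>

lemma derives_subst_at:
  assumes "derives t \<Gamma> a m" "bag (derives s) \<Delta> (\<Gamma> x) q"
  shows "\<exists>n\<le>m + q. derives (psubst (subst_at x s) t)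
    ((\<lambda>i. \<Gamma> (if i < x then i else Suc i)) + \<Delta>) a n"
  using assms
proof (induction t arbitrary: \<Gamma> a m s \<Delta> x q)
  case (Var i)
  show ?case
  proof (cases "i = x")
    case True
    \<comment> \<open>One element of the bag serves this axiom. The others are dropped, and
      weakening absorbs their environment.\<close>
    with Var have "\<Gamma> x = {#a#} + (\<Gamma> x - {#a#})" by simp
    with Var(2) obtain \<Gamma>1 \<Gamma>2 n1 n2 where
      *: "\<Delta> = \<Gamma>1 + \<Gamma>2" "q = n1 + n2" "bag (derives s) \<Gamma>1 {#a#} n1"
      by (metis bag_split)
    from bag_singleD[OF *(3)] obtain \<Gamma>3 \<Gamma>4 where "\<Gamma>1 = \<Gamma>3 + \<Gamma>4" "derives s \<Gamma>3 a n1"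
      by blast
    then have "derives s (\<Gamma>3 + (\<Gamma>4 + \<Gamma>2 + (\<lambda>i. \<Gamma> (if i < x then i else Suc i)))) a n1"
      by (intro derives_weaken)
    also have "\<Gamma>3 + (\<Gamma>4 + \<Gamma>2 + (\<lambda>i. \<Gamma> (if i < x then i else Suc i)))
      = (\<lambda>i. \<Gamma> (if i < x then i else Suc i)) + \<Delta>"
      using * \<open>\<Gamma>1 = \<Gamma>3 + \<Gamma>4\<close> by (simp add: ac_simps)
    finally have "derives (psubst (subst_at x s) (Var i))
        ((\<lambda>i. \<Gamma> (if i < x then i else Suc i)) + \<Delta>) a n1"
      using True by (simp add: subst_at_def)
    then show ?thesis using *(2) by (intro exI[of _ n1]) simp
  next
    case False
    then have "(if i < x then i else Suc (i - 1)) = i" by auto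
    with False Var show ?thesis by (auto simp: subst_at_def plus_fun_apply)
  qed
next
  case (Lam A t)
  then obtain M b where M: "a = Fn M b" "derives t (case_nat M \<Gamma>) b m" by auto
  have "bag (derives (shift 1 s)) (case_nat {#} \<Delta>) (case_nat M \<Gamma> (Suc x)) q"
    using bag_shift[OF Lam.prems(2), of 1] by (simp add: shift_env_Suc)
  from Lam.IH[OF M(2) this] obtain n where n: "n \<le> m + q"
    "derives (psubst (subst_at (Suc x) (shift 1 s)) t)
      ((\<lambda>i. case_nat M \<Gamma> (if i < Suc x then i else Suc i)) + case_nat {#} \<Delta>) b n" by blast
  have "(\<lambda>i. case_nat M \<Gamma> (if i < Suc x then i else Suc i)) + case_nat {#} \<Delta>
    = case_nat M ((\<lambda>i. \<Gamma> (if i < x then i else Suc i)) + \<Delta>)"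
    by (rule ext) (simp add: plus_fun_apply split: nat.split)
  moreover have "subst_at (Suc x) (shift 1 s) = case_nat (Var 0) (\<lambda>i. shift 1 (subst_at x s i))"
    by (rule ext) (auto simp: subst_at_def shift_def split: nat.split)
  ultimately show ?case using M(1) n by auto
next
  case (App t u)
  then obtain \<Gamma>1 \<Gamma>2 M w n1 n2 where *: "\<Gamma> = \<Gamma>1 + \<Gamma>2" "m = n1 + n2"
    "derives t \<Gamma>1 (Fn M a) n1" "bag (derives u) \<Gamma>2 (add_mset w M) n2" by auto
  let ?\<sigma> = "subst_at x s" and ?drop = "\<lambda>\<Gamma> i. \<Gamma> (if i < x then i else Suc i)"
  from App.prems(2) *(1) obtain \<Delta>1 \<Delta>2 q1 q2 where **: "\<Delta> = \<Delta>1 + \<Delta>2" "q = q1 + q2"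
    "bag (derives s) \<Delta>1 (\<Gamma>1 x) q1" "bag (derives s) \<Delta>2 (\<Gamma>2 x) q2"
    using bag_split[of "derives s" \<Delta> "\<Gamma>1 x" "\<Gamma>2 x" q]
    unfolding plus_fun_apply by blast
  \<comment> \<open>Each derivation of \<open>u\<close> needs its own share of the bag for
    \<open>x\<close>, so an inner induction over the bag of \<open>u\<close> splits the derivations
    of \<open>s\<close> again.\<close>
  have "\<exists>n\<le>n2 + q2. bag (derives (psubst ?\<sigma> u)) (?drop \<Gamma>2 + \<Delta>2) N n"
    if "bag (derives u) \<Gamma>2 N n2" "N \<noteq> {#}" "bag (derives s) \<Delta>2 (\<Gamma>2 x) q2" for N \<Gamma>2 n2 \<Delta>2 q2
    using that
  proof (induction arbitrary: \<Delta>2 q2)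
    case (add \<Gamma>3 b k \<Gamma>4 N l)
    from add.prems(2) obtain \<Delta>3 \<Delta>4 q3 q4 where s: "\<Delta>2 = \<Delta>3 + \<Delta>4" "q2 = q3 + q4"
      "bag (derives s) \<Delta>3 (\<Gamma>3 x) q3" "bag (derives s) \<Delta>4 (\<Gamma>4 x) q4"
      using bag_split[of "derives s" \<Delta>2 "\<Gamma>3 x" "\<Gamma>4 x" q2]
      unfolding plus_fun_apply by blast
    from App.IH(2)[OF add.hyps(1) s(3)] obtain k' where
      k': "k' \<le> k + q3" "derives (psubst ?\<sigma> u) (?drop \<Gamma>3 + \<Delta>3) b k'" by blast
    obtain l' where l': "l' \<le> l + q4" "bag (derives (psubst ?\<sigma> u)) (?drop \<Gamma>4 + \<Delta>4) N l'"
    proof (cases "N = {#}")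
      case True
      then show ?thesis using that[of 0] by simp
    next
      case False
      then show ?thesis using add.IH[OF _ s(4)] that by blast
    qed
    have "?drop (\<Gamma>3 + \<Gamma>4) + \<Delta>2 = (?drop \<Gamma>3 + \<Delta>3) + (?drop \<Gamma>4 + \<Delta>4)"
      using s(1) by (auto simp: fun_eq_iff plus_fun_apply ac_simps)
    then have "bag (derives (psubst ?\<sigma> u)) (?drop (\<Gamma>3 + \<Gamma>4) + \<Delta>2) (add_mset b N) (k' + l')"
      using bag.add[OF k'(2) l'(2)] by simp
    moreover have "k' + l' \<le> k + l + q2" using k' l' s(2) by simp
    ultimately show ?case by blast
  qed simp
  from this[OF *(4) _ **(4)] obtain k2 where k2: "k2 \<le> n2 + q2"
    "bag (derives (psubst ?\<sigma> u)) (?drop \<Gamma>2 + \<Delta>2) (add_mset w M) k2" by auto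
  from App.IH(1)[OF *(3) **(3)] obtain k1 where k1: "k1 \<le> n1 + q1"
    "derives (psubst ?\<sigma> t) (?drop \<Gamma>1 + \<Delta>1) (Fn M a) k1" by blast
  have "?drop \<Gamma> + \<Delta> = (?drop \<Gamma>1 + \<Delta>1) + (?drop \<Gamma>2 + \<Delta>2)"
    using *(1) **(1) by (auto simp: fun_eq_iff plus_fun_apply ac_simps)
  with derives_App[OF k1(2) k2(2)]
  have "derives (psubst ?\<sigma> (App t u)) (?drop \<Gamma> + \<Delta>) a (k1 + k2)" by simp
  moreover have "k1 + k2 \<le> m + q" using k1 k2 * ** by simp
  ultimately show ?case by blast
qed

lemma derives_subst:
  assumes "derives t (case_nat M \<Gamma>) a m" "bag (derives s) \<Delta> M q"
  shows "\<exists>n\<le>m + q. derives (subst t s) (\<Gamma> + \<Delta>) a n"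
proof -
  have "subst_at 0 s = case_nat s Var"
    by (rule ext) (simp add: subst_at_def split: nat.split)
  then show ?thesis
    using derives_subst_at[OF assms(1), of s \<Delta> 0 q] assms(2) by (simp add: subst_def)
qed

text \<open>The bag of the argument splits into \<open>M\<close>, whose derivations are substituted
  and whose environment crosses \<open>E\<close> as a frame, and \<open>w\<close>, whose derivation
  is dropped. The latter contains an axiom, which makes the bound strict.\<close>

lemma decreases_betad_root: "betad_root t u \<Longrightarrow> decreases t u"
proof (induction rule: betad_root.induct)
  case (1 E A t s)
  obtain R where R:
    "\<And>t \<Gamma> a n. derives (plug E t) \<Gamma> a n \<longleftrightarrow> (\<exists>\<Gamma>' k m. R \<Gamma> \<Gamma>' k \<and> derives t \<Gamma>' a m \<and> n = k + m)"
    "\<And>\<Gamma> \<Gamma>' k \<Delta>. R \<Gamma> \<Gamma>' k \<Longrightarrow> R (\<Gamma> + \<Delta>) (\<Gamma>' + shift_env (depth E) \<Delta>) k"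
    using Ectx_derives[OF 1] by metis
  let ?u = "subst t (shift (depth E) s)"
  show ?case unfolding decreases_def
  proof (intro allI impI)
    fix \<Gamma> a n
    assume "derives (App (plug E (Lam A t)) s) \<Gamma> a n"
    then obtain \<Gamma>1 \<Gamma>2 M w k m n2 \<Gamma>' where *: "\<Gamma> = \<Gamma>1 + \<Gamma>2" "n = k + m + n2" "R \<Gamma>1 \<Gamma>' k"
      "derives t (case_nat M \<Gamma>') a m" "bag (derives s) \<Gamma>2 ({#w#} + M) n2" by (auto simp: R(1))
    from bag_split[OF *(5)] obtain \<Gamma>3 \<Gamma>4 n3 n4 where **: "\<Gamma>2 = \<Gamma>3 + \<Gamma>4" "n2 = n3 + n4"
      "bag (derives s) \<Gamma>3 {#w#} n3" "bag (derives s) \<Gamma>4 M n4" by blast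
    obtain l where l: "l \<le> m + n4" "derives ?u (\<Gamma>' + shift_env (depth E) \<Gamma>4) a l"
      using derives_subst[OF *(4) bag_shift[OF **(4)]] by blast
    then have "derives (plug E ?u) (\<Gamma>1 + \<Gamma>4) a (k + l)"
      using R *(3) by blast
    then have "derives (plug E ?u) (\<Gamma>1 + \<Gamma>4 + \<Gamma>3) a (k + l)" by (rule derives_weaken)
    moreover have "\<Gamma> = \<Gamma>1 + \<Gamma>4 + \<Gamma>3" using * ** by (simp add: ac_simps)
    moreover have "k + l < n" using bag_pos[OF **(3)] l * ** by simp
    ultimately show "\<exists>m<n. derives (plug E ?u) \<Gamma> a m" by auto
  qed
qed

section \<open>Linear substitution\<close>

text \<open>\<open>K\<close> collects the points at which the displayed occurrence of the variable \<open>x\<close> is typed; it is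
  nonempty because arguments are always typed at least once.\<close>
definition linear_subst ::
  "nat \<Rightarrow> tm \<Rightarrow> env \<Rightarrow> nat \<Rightarrow> (env \<Rightarrow> nat \<Rightarrow> bool) \<Rightarrow> bool" where
  "linear_subst x s \<Gamma> m Q \<longleftrightarrow> (\<exists>K L k. \<Gamma> x = K + L \<and> K \<noteq> {#} \<and>
     k < m \<and> (\<forall>\<Delta> q. bag (derives s) \<Delta> K q \<longrightarrow> Q (\<Gamma>(x := L) + \<Delta>) (k + q)))"

text \<open>One occurrence in the term can thus be replaced in two derivations at once, as happens
  in an argument that is typed several times.\<close>

lemma linear_subst_plus:
  assumes "linear_subst x s \<Gamma>1 m1 Q1" "linear_subst x s \<Gamma>2 m2 Q2"
    and "\<And>\<Gamma>1 \<Gamma>2 n1 n2. Q1 \<Gamma>1 n1 \<Longrightarrow> Q2 \<Gamma>2 n2 \<Longrightarrow> Q (\<Gamma>1 + \<Gamma>2) (n1 + n2)"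
  shows "linear_subst x s (\<Gamma>1 + \<Gamma>2) (m1 + m2) Q"
proof -
  obtain K1 L1 k1 where 1: "\<Gamma>1 x = K1 + L1" "K1 \<noteq> {#}" "k1 < m1"
    "\<And>\<Delta> q. bag (derives s) \<Delta> K1 q \<Longrightarrow> Q1 (\<Gamma>1(x := L1) + \<Delta>) (k1 + q)"
    using assms(1) unfolding linear_subst_def by blast
  obtain K2 L2 k2 where 2: "\<Gamma>2 x = K2 + L2" "K2 \<noteq> {#}" "k2 < m2"
    "\<And>\<Delta> q. bag (derives s) \<Delta> K2 q \<Longrightarrow> Q2 (\<Gamma>2(x := L2) + \<Delta>) (k2 + q)"
    using assms(2) unfolding linear_subst_def by blast
  have "Q ((\<Gamma>1 + \<Gamma>2)(x := L1 + L2) + \<Delta>) (k1 + k2 + q)"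
    if bag: "bag (derives s) \<Delta> (K1 + K2) q" for \<Delta> q
  proof -
    obtain \<Delta>1 \<Delta>2 q1 q2 where s: "\<Delta> = \<Delta>1 + \<Delta>2" "q = q1 + q2"
      "bag (derives s) \<Delta>1 K1 q1" "bag (derives s) \<Delta>2 K2 q2"
      using bag_split[OF bag] by blast
    have "(\<Gamma>1 + \<Gamma>2)(x := L1 + L2) + \<Delta> = (\<Gamma>1(x := L1) + \<Delta>1) + (\<Gamma>2(x := L2) + \<Delta>2)"
      using s(1) by (auto simp: fun_eq_iff plus_fun_apply ac_simps)
    moreover have "k1 + k2 + q = (k1 + q1) + (k2 + q2)" using s(2) by simp
    ultimately show ?thesis using assms(3) 1(4) 2(4) s(3,4) by metis
  qed
  then show ?thesis unfolding linear_subst_def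
    using 1(1-3) 2(1-3)
    by (intro exI[of _ "K1 + K2"] exI[of _ "L1 + L2"] exI[of _ "k1 + k2"]) (auto simp: plus_fun_apply ac_simps)
qed

text \<open>For subterms away from the displayed occurrence: their points at \<open>x\<close> join
  \<open>L\<close>, so that their own axioms for \<open>x\<close> survive.\<close>

lemma linear_subst_frame:
  assumes "linear_subst x s \<Gamma>1 m1 Q1"
    and "\<And>\<Gamma>1 n1. Q1 \<Gamma>1 n1 \<Longrightarrow> Q (\<Gamma>1 + \<Gamma>2) (n1 + m2)"
  shows "linear_subst x s (\<Gamma>1 + \<Gamma>2) (m1 + m2) Q"
proof -
  obtain K L k where 1: "\<Gamma>1 x = K + L" "K \<noteq> {#}" "k < m1"
    "\<And>\<Delta> q. bag (derives s) \<Delta> K q \<Longrightarrow> Q1 (\<Gamma>1(x := L) + \<Delta>) (k + q)"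
    using assms(1) unfolding linear_subst_def by blast
  have "Q ((\<Gamma>1 + \<Gamma>2)(x := L + \<Gamma>2 x) + \<Delta>) (k + m2 + q)" if "bag (derives s) \<Delta> K q" for \<Delta> q
  proof -
    have "(\<Gamma>1 + \<Gamma>2)(x := L + \<Gamma>2 x) + \<Delta> = (\<Gamma>1(x := L) + \<Delta>) + \<Gamma>2"
      by (auto simp: fun_eq_iff plus_fun_apply ac_simps)
    moreover have "k + m2 + q = (k + q) + m2" by simp
    ultimately show ?thesis using assms(2) 1(4) that by metis
  qed
  then show ?thesis unfolding linear_subst_def
    using 1(1-3)
    by (intro exI[of _ K] exI[of _ "L + \<Gamma>2 x"] exI[of _ "k + m2"]) (auto simp: plus_fun_apply ac_simps)
qed

text \<open>The base case is a single element, since an empty bag offers neither a nonempty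
  \<open>K\<close> nor a count below \<open>0\<close>.\<close>

lemma linear_subst_bag:
  assumes "bag P \<Gamma> M n" "M \<noteq> {#}"
    and "\<And>\<Gamma> a n. P \<Gamma> a n \<Longrightarrow> linear_subst x s \<Gamma> n (\<lambda>\<Gamma>. Q \<Gamma> a)"
  shows "linear_subst x s \<Gamma> n (\<lambda>\<Gamma>. bag Q \<Gamma> M)"
  using assms(1,2)
proof induction
  case (add \<Gamma> a n \<Delta> M m)
  show ?case
  proof (cases "M = {#}")
    case True
    then have "m = 0" using add.hyps(2) by simp
    with True show ?thesis
      by (intro linear_subst_frame[OF assms(3)[OF add.hyps(1)]] bag.add) auto
  next
    case False
    show ?thesis
      by (rule linear_subst_plus[OF assms(3)[OF add.hyps(1)] add.IH[OF False]]) (rule bag.add)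
  qed
qed simp

text \<open>Each axiom at the occurrence, of cost 1, gives way to a derivation of \<open>s\<close>
  at the same point. The count of the axioms that stay is therefore strictly below \<open>n\<close>;
  at the hole itself it is \<open>0\<close>.\<close>

lemma derives_plug_Var:
  assumes "derives (plug C (Var (x + depth C))) \<Gamma> a n"
  shows "linear_subst x s \<Gamma> n (\<lambda>\<Gamma>. derives (plug C (shift (depth C) s)) \<Gamma> a)"
  using assms
proof (induction C arbitrary: x s \<Gamma> a n)
  case Hole
  then have "\<Gamma> x = {#a#} + (\<Gamma> x - {#a#})" "n = 1" by auto
  moreover have "derives s (\<Gamma>' + \<Delta>) a q" if "bag (derives s) \<Delta> {#a#} q" for \<Gamma>' \<Delta> q
  proof -
    from bag_singleD[OF that] obtain \<Delta>1 \<Delta>2 where \<Delta>: "\<Delta> = \<Delta>1 + \<Delta>2" "derives s \<Delta>1 a q" by blast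
    then have "derives s (\<Delta>1 + (\<Delta>2 + \<Gamma>')) a q" by (intro derives_weaken)
    with \<Delta>(1) show ?thesis by (simp add: ac_simps)
  qed
  ultimately show ?case unfolding linear_subst_def
    by (intro exI[of _ "{#a#}"] exI[of _ "\<Gamma> x - {#a#}"] exI[of _ 0]) auto
next
  case (CLam A C)
  then obtain M b where M: "a = Fn M b"
    "derives (plug C (Var (Suc x + depth C))) (case_nat M \<Gamma>) b n" by auto
  from CLam.IH[OF M(2), of "shift 1 s"] obtain K L k where
    1: "\<Gamma> x = K + L" "K \<noteq> {#}" "k < n"
    "\<And>\<Delta> q. bag (derives (shift 1 s)) \<Delta> K q \<Longrightarrow>
      derives (plug C (shift (depth C) (shift 1 s))) ((case_nat M \<Gamma>)(Suc x := L) + \<Delta>) b (k + q)"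
    unfolding linear_subst_def by auto
  have "derives (plug C (shift (Suc (depth C)) s)) (case_nat M (\<Gamma>(x := L) + \<Delta>)) b (k + q)"
    if "bag (derives s) \<Delta> K q" for \<Delta> q
  proof -
    have "(case_nat M \<Gamma>)(Suc x := L) + shift_env 1 \<Delta> = case_nat M (\<Gamma>(x := L) + \<Delta>)"
      by (rule ext) (auto simp: shift_env_Suc plus_fun_apply split: nat.split)
    then show ?thesis
      using 1(4)[OF bag_shift[OF that, of 1]] by (simp add: shift_shift)
  qed
  then show ?case unfolding linear_subst_def using 1(1-3) M(1) by auto
next
  case (CAppL C u)
  then obtain \<Gamma>1 \<Gamma>2 M w n1 n2 where *: "\<Gamma> = \<Gamma>1 + \<Gamma>2" "n = n1 + n2"
    "derives (plug C (Var (x + depth C))) \<Gamma>1 (Fn M a) n1"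
    "bag (derives u) \<Gamma>2 (add_mset w M) n2" by auto
  show ?case unfolding *(1,2)
    by (rule linear_subst_frame[OF CAppL.IH[OF *(3)]])
      (simp only: plug.simps depth.simps, erule derives_App[OF _ *(4)])
next
  case (CAppR u C)
  then obtain \<Gamma>1 \<Gamma>2 M w n1 n2 where *: "\<Gamma> = \<Gamma>1 + \<Gamma>2" "n = n1 + n2"
    "derives u \<Gamma>1 (Fn M a) n1"
    "bag (derives (plug C (Var (x + depth C)))) \<Gamma>2 (add_mset w M) n2" by auto
  \<comment> \<open>The occurrence lies in the argument, hence in every derivation of the bag, and
    \<open>w\<close> keeps the bag nonempty. The function part is the frame, so the sums are
    swapped.\<close>
  have "linear_subst x s (\<Gamma>2 + \<Gamma>1) (n2 + n1)
      (\<lambda>\<Gamma>. derives (plug (CAppR u C) (shift (depth (CAppR u C)) s)) \<Gamma> a)"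
  proof (rule linear_subst_frame[OF linear_subst_bag[OF *(4)]])
    show "linear_subst x s \<Gamma> n (\<lambda>\<Gamma>. derives (plug C (shift (depth C) s)) \<Gamma> a)"
      if "derives (plug C (Var (x + depth C))) \<Gamma> a n" for \<Gamma> a n
      using CAppR.IH[OF that] .
    show "derives (plug (CAppR u C) (shift (depth (CAppR u C)) s)) (\<Delta> + \<Gamma>1) a (q + n1)"
      if "bag (derives (plug C (shift (depth C) s))) \<Delta> (add_mset w M) q" for \<Delta> q
      using derives_App[OF *(3) that]
      unfolding plug.simps depth.simps by (subst (1 2) add.commute)
  qed simp
  then show ?case unfolding *(1,2) by (subst (1 2) add.commute)
qed

text \<open>Derivations of the argument are moved, neither copied nor lost: those at the points of
  the occurrence go into the new copy, the rest stay with the argument. Only the replaced axioms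
  disappear.\<close>

lemma decreases_lin_root: "lin_root K t u \<Longrightarrow> decreases t u"
proof (induction rule: lin_root.induct)
  case (1 E C A s)
  obtain R where R:
    "\<And>t \<Gamma> a n. derives (plug E t) \<Gamma> a n \<longleftrightarrow> (\<exists>\<Gamma>' k m. R \<Gamma> \<Gamma>' k \<and> derives t \<Gamma>' a m \<and> n = k + m)"
    "\<And>\<Gamma> \<Gamma>' k \<Delta>. R \<Gamma> \<Gamma>' k \<Longrightarrow> R (\<Gamma> + \<Delta>) (\<Gamma>' + shift_env (depth E) \<Delta>) k"
    using Ectx_derives[OF 1(1)] by metis
  let ?s = "shift (depth E + 1) s"
  let ?t = "plug C (shift (depth E + 1 + depth C) s)"
  show ?case unfolding decreases_def
  proof (intro allI impI)
    fix \<Gamma> a n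
    assume "derives (App (plug E (Lam A (plug C (Var (depth C))))) s) \<Gamma> a n"
    then obtain \<Gamma>1 \<Gamma>2 M w k m n2 \<Gamma>' where *: "\<Gamma> = \<Gamma>1 + \<Gamma>2" "n = k + m + n2" "R \<Gamma>1 \<Gamma>' k"
      "derives (plug C (Var (0 + depth C))) (case_nat M \<Gamma>') a m"
      "bag (derives s) \<Gamma>2 (add_mset w M) n2"
      by (auto simp: R(1))
    from derives_plug_Var[OF *(4), of ?s] obtain K L l where
      l: "M = K + L" "l < m"
      "\<And>\<Delta> q. bag (derives ?s) \<Delta> K q \<Longrightarrow> derives ?t ((case_nat M \<Gamma>')(0 := L) + \<Delta>) a (l + q)"
      unfolding linear_subst_def shift_shift by auto
    \<comment> \<open>\<open>w\<close> stays with \<open>L\<close>, so that the remaining argument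
      again has one derivation more than its function asks for.\<close>
    from *(5) l(1) have "bag (derives s) \<Gamma>2 (K + add_mset w L) n2" by simp
    from bag_split[OF this] obtain \<Gamma>3 \<Gamma>4 n3 n4 where **: "\<Gamma>2 = \<Gamma>3 + \<Gamma>4" "n2 = n3 + n4"
      "bag (derives s) \<Gamma>3 K n3" "bag (derives s) \<Gamma>4 (add_mset w L) n4" by blast
    have "(case_nat M \<Gamma>')(0 := L) + shift_env (depth E + 1) \<Gamma>3
      = case_nat L (\<Gamma>' + shift_env (depth E) \<Gamma>3)"
      by (rule ext) (auto simp: shift_env_Suc plus_fun_apply split: nat.split)
    then have "derives (Lam A ?t) (\<Gamma>' + shift_env (depth E) \<Gamma>3) (Fn L a) (l + n3)"
      using l(3)[OF bag_shift[OF **(3)]] by simp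
    \<comment> \<open>The point of the abstraction has changed from \<open>Fn M a\<close> to
      \<open>Fn L a\<close>. As \<open>R\<close> does not mention the point, \<open>E\<close>
      accepts both.\<close>
    then have "derives (plug E (Lam A ?t)) (\<Gamma>1 + \<Gamma>3) (Fn L a) (k + (l + n3))"
      using R *(3) by blast
    then have "derives (App (plug E (Lam A ?t)) s) ((\<Gamma>1 + \<Gamma>3) + \<Gamma>4) a ((k + (l + n3)) + n4)"
      using **(4) unfolding derives.simps by blast
    moreover have "\<Gamma> = (\<Gamma>1 + \<Gamma>3) + \<Gamma>4" using * ** by (simp add: ac_simps)
    moreover have "(k + (l + n3)) + n4 < n" using l * ** by simp
    ultimately show "\<exists>m<n. derives (App (plug E (Lam A ?t)) s) \<Gamma> a m" by metis
  qed
qed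

section \<open>Totality in the relational model\<close>

text \<open>A logical predicate on sets of points; the set in the arrow case is the application of
  \<open>X\<close> to \<open>Y\<close> in the model.\<close>

primrec total :: "ty \<Rightarrow> point set \<Rightarrow> bool" where
  "total Base X \<longleftrightarrow> X \<noteq> {}"
| "total (Arr A B) X \<longleftrightarrow> (\<forall>Y. total A Y \<longrightarrow> total B {b. \<exists>M. set_mset M \<subseteq> Y \<and> Fn M b \<in> X})"

text \<open>The empty multiset lies within every \<open>Y\<close>, so every \<open>b\<close> is a
  result.\<close>

lemma total_UNIV: "total A UNIV"
proof (induction A)
  case (Arr A B)
  have "{b. \<exists>M. set_mset M \<subseteq> Y \<and> Fn M b \<in> UNIV} = UNIV" for Y
    by (auto intro: exI[of _ "{#}"])
  with Arr show ?case by simp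
qed simp

text \<open>Applying \<open>X\<close> to the total argument \<open>UNIV\<close> gives a set that is
  nonempty by induction, and each of its elements stems from some \<open>Fn M b\<close> in
  \<open>X\<close>.\<close>

lemma total_nonempty: "total A X \<Longrightarrow> X \<noteq> {}"
proof (induction A arbitrary: X)
  case (Arr A B)
  then show ?case using total_UNIV by fastforce
qed simp

text \<open>Bounds by sets forget multiplicity, so environments below \<open>\<rho>\<close> may be
  added freely, as bags and applications require.\<close>

definition interp :: "tm \<Rightarrow> (nat \<Rightarrow> point set) \<Rightarrow> point set" where
  "interp t \<rho> = {a. \<exists>\<Gamma> n. derives t \<Gamma> a n \<and> (\<forall>i. set_mset (\<Gamma> i) \<subseteq> \<rho> i)}"

lemma interp_Var: "interp (Var i) \<rho> = \<rho> i"
proof -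
  have "a \<in> interp (Var i) \<rho>" if "a \<in> \<rho> i" for a
    unfolding interp_def using that
    by (auto intro!: exI[of _ "(\<lambda>_. {#})(i := {#a#})"] split: if_splits)
  then show ?thesis by (auto simp: interp_def)
qed

text \<open>The semantic counterpart of beta: the multiset \<open>M\<close> is what the environment
  of the body holds at index 0.\<close>

lemma interp_Lam:
  "{b. \<exists>M. set_mset M \<subseteq> X \<and> Fn M b \<in> interp (Lam A t) \<rho>} = interp t (case_nat X \<rho>)"
proof (intro set_eqI iffI)
  fix b
  assume "b \<in> interp t (case_nat X \<rho>)"
  then obtain \<Gamma> n where *: "derives t \<Gamma> b n" "\<And>i. set_mset (\<Gamma> i) \<subseteq> case_nat X \<rho> i"
    unfolding interp_def by blast
  have "\<Gamma> = case_nat (\<Gamma> 0) (\<lambda>i. \<Gamma> (Suc i))" by (rule ext) (simp add: plus_fun_apply split: nat.split)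
  with *(1) have "derives (Lam A t) (\<lambda>i. \<Gamma> (Suc i)) (Fn (\<Gamma> 0) b) n" by simp
  moreover have "set_mset (\<Gamma> (Suc i)) \<subseteq> \<rho> i" for i using *(2)[of "Suc i"] by simp
  moreover have "set_mset (\<Gamma> 0) \<subseteq> X" using *(2)[of 0] by simp
  ultimately show "b \<in> {b. \<exists>M. set_mset M \<subseteq> X \<and> Fn M b \<in> interp (Lam A t) \<rho>}"
    unfolding interp_def by blast
next
  fix b
  assume "b \<in> {b. \<exists>M. set_mset M \<subseteq> X \<and> Fn M b \<in> interp (Lam A t) \<rho>}"
  then obtain M \<Gamma> n where "set_mset M \<subseteq> X" "derives t (case_nat M \<Gamma>) b n"
    "\<And>i. set_mset (\<Gamma> i) \<subseteq> \<rho> i" unfolding interp_def by auto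
  moreover from this have "set_mset (case_nat M \<Gamma> i) \<subseteq> case_nat X \<rho> i" for i
    by (simp split: nat.split)
  ultimately show "b \<in> interp t (case_nat X \<rho>)" unfolding interp_def by blast
qed

lemma interp_bag:
  "set_mset M \<subseteq> interp s \<rho> \<longleftrightarrow> (\<exists>\<Gamma> n. bag (derives s) \<Gamma> M n \<and> (\<forall>i. set_mset (\<Gamma> i) \<subseteq> \<rho> i))"
proof
  assume "set_mset M \<subseteq> interp s \<rho>"
  then show "\<exists>\<Gamma> n. bag (derives s) \<Gamma> M n \<and> (\<forall>i. set_mset (\<Gamma> i) \<subseteq> \<rho> i)"
  proof (induction M)
    case empty
    then show ?case by (auto intro!: exI[of _ "\<lambda>_. {#}"] bag.empty)
  next
    case (add a M)
    then obtain \<Gamma> n \<Delta> m where "bag (derives s) \<Delta> M m" "\<forall>i. set_mset (\<Delta> i) \<subseteq> \<rho> i"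
      "derives s \<Gamma> a n" "\<forall>i. set_mset (\<Gamma> i) \<subseteq> \<rho> i" by (auto simp: interp_def)
    then show ?case
      by (intro exI[of _ "\<Gamma> + \<Delta>"] exI[of _ "n + m"] conjI bag.add) (auto simp: plus_fun_apply)
  qed
next
  assume "\<exists>\<Gamma> n. bag (derives s) \<Gamma> M n \<and> (\<forall>i. set_mset (\<Gamma> i) \<subseteq> \<rho> i)"
  then obtain \<Gamma> n where "bag (derives s) \<Gamma> M n" "\<forall>i. set_mset (\<Gamma> i) \<subseteq> \<rho> i" by blast
  then show "set_mset M \<subseteq> interp s \<rho>"
    by induction (auto simp: interp_def plus_fun_apply)
qed

text \<open>The hypothesis provides the extra point \<open>w\<close> that the typing of an
  application demands.\<close>

lemma interp_App:
  assumes "interp s \<rho> \<noteq> {}"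
  shows "interp (App t s) \<rho> = {b. \<exists>M. set_mset M \<subseteq> interp s \<rho> \<and> Fn M b \<in> interp t \<rho>}"
proof (intro set_eqI iffI)
  fix b
  assume "b \<in> interp (App t s) \<rho>"
  then obtain \<Gamma>1 \<Gamma>2 M w n1 n2 where *: "derives t \<Gamma>1 (Fn M b) n1"
    "bag (derives s) \<Gamma>2 (add_mset w M) n2" "\<And>i. set_mset ((\<Gamma>1 + \<Gamma>2) i) \<subseteq> \<rho> i"
    by (auto simp: interp_def)
  then have "set_mset (\<Gamma>1 i) \<subseteq> \<rho> i" "set_mset (\<Gamma>2 i) \<subseteq> \<rho> i" for i
    using *(3)[of i] by (auto simp: plus_fun_apply)
  with *(1,2) have "set_mset (add_mset w M) \<subseteq> interp s \<rho>" "Fn M b \<in> interp t \<rho>"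
    unfolding interp_bag by (auto simp: interp_def)
  then show "b \<in> {b. \<exists>M. set_mset M \<subseteq> interp s \<rho> \<and> Fn M b \<in> interp t \<rho>}" by auto
next
  fix b
  assume "b \<in> {b. \<exists>M. set_mset M \<subseteq> interp s \<rho> \<and> Fn M b \<in> interp t \<rho>}"
  then obtain M where M: "set_mset M \<subseteq> interp s \<rho>" "Fn M b \<in> interp t \<rho>" by blast
  from assms obtain w where "w \<in> interp s \<rho>" by blast
  with M(1) have "set_mset (add_mset w M) \<subseteq> interp s \<rho>" by simp
  then obtain \<Gamma>2 n2 where 2: "bag (derives s) \<Gamma>2 (add_mset w M) n2" "\<forall>i. set_mset (\<Gamma>2 i) \<subseteq> \<rho> i"
    unfolding interp_bag by blast
  from M(2) obtain \<Gamma>1 n1 where 1: "derives t \<Gamma>1 (Fn M b) n1" "\<forall>i. set_mset (\<Gamma>1 i) \<subseteq> \<rho> i"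
    unfolding interp_def by blast
  have "derives (App t s) (\<Gamma>1 + \<Gamma>2) b (n1 + n2)" using 1(1) 2(1) by (rule derives_App)
  moreover have "\<forall>i. set_mset ((\<Gamma>1 + \<Gamma>2) i) \<subseteq> \<rho> i" using 1(2) 2(2) by (simp add: plus_fun_apply)
  ultimately show "b \<in> interp (App t s) \<rho>" unfolding interp_def by blast
qed

text \<open>The fundamental lemma of the logical predicate. In the application case, totality of the
  argument also yields the nonemptiness that \<open>interp_App\<close> asks for.\<close>

lemma total_interp:
  assumes "has_type \<Gamma> t A" "\<And>i. total (\<Gamma> i) (\<rho> i)"
  shows "total A (interp t \<rho>)"
  using assms
proof (induction arbitrary: \<rho>)
  case (1 \<Gamma> i)
  then show ?case by (simp add: interp_Var)
next
  case (2 A \<Gamma> t B)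
  have "total B (interp t (case_nat X \<rho>))" if "total A X" for X
    using 2 that by (auto split: nat.split)
  then show ?case by (simp add: interp_Lam)
next
  case (3 \<Gamma> t A B s)
  then have "total A (interp s \<rho>)" "total (Arr A B) (interp t \<rho>)" by blast+
  then show ?case using interp_App total_nonempty by simp
qed

text \<open>All free variables are valued by \<open>UNIV\<close>, which is total at whatever types
  they have.\<close>

lemma has_type_derives:
  assumes "has_type \<Gamma> t A"
  obtains \<Delta> a n where "derives t \<Delta> a n"
  using total_nonempty[OF total_interp[OF assms total_UNIV]] that
  by (auto simp: interp_def)

section \<open>Strong normalisation of the six systems\<close>

text \<open>Along a reduction sequence environment and point stay fixed while the count falls.
  Simple typing provides the derivation of the first term.\<close>

lemma decreases_strongly_normalising:
  assumes "\<And>t u. R t u \<Longrightarrow> decreases t u"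
  shows "strongly_normalising R"
proof -
  have "SN_at R t" if "derives t \<Gamma> a n" for t \<Gamma> a n
    using that
  proof (induction n arbitrary: t rule: less_induct)
    case (less n)
    show ?case unfolding SN_at_def
    proof
      assume "\<exists>f. f 0 = t \<and> (\<forall>i. R (f i) (f (Suc i)))"
      then obtain f where f: "f 0 = t" "\<And>i. R (f i) (f (Suc i))" by blast
      then have "decreases t (f 1)" using assms[of "f 0" "f 1"] f(2)[of 0] by simp
      with less.prems obtain m where "m < n" "derives (f 1) \<Gamma> a m"
        unfolding decreases_def by blast
      then have "SN_at R (f 1)" by (rule less.IH)
      then show False unfolding SN_at_def using f(2) by (auto dest: spec[of _ "\<lambda>i. f (Suc i)"])
    qed
  qed
  then show ?thesis
    unfolding strongly_normalising_def by (meson has_type_derives)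
qed

text \<open>The E-context is \<open>Hole\<close>, where the argument is shifted by 0.\<close>

lemma beta_root_betad_root: "beta_root t u \<Longrightarrow> betad_root t u"
  by (induction rule: beta_root.induct) (use betad_root.intros[OF Ectx.intros(1)] in simp)

text \<open>One context serves all \<open>t\<close>, so that redex and contractum share it. The last
  argument is outermost, hence the induction from the right.\<close>

lemma foldl_App_plug: "\<exists>C. \<forall>t. foldl App t us = plug C t"
proof (induction us rule: rev_induct)
  case Nil
  show ?case by (auto intro: exI[of _ Hole])
next
  case (snoc u us)
  then obtain C where "\<forall>t. foldl App t us = plug C t" by blast
  then show ?case by (auto intro: exI[of _ "CAppL C u"])
qed

lemma foldr_Lam_plug: "\<exists>C. \<forall>t. foldr Lam As t = plug C t"
proof (induction As)
  case Nil
  show ?case by (auto intro: exI[of _ Hole])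
next
  case (Cons A As)
  then obtain C where "\<forall>t. foldr Lam As t = plug C t" by blast
  then show ?case by (auto intro: exI[of _ "CLam A C"])
qed

lemma red_head_red_beta: "red_head t u \<Longrightarrow> red_beta t u"
proof (induction rule: red_head.induct)
  case (1 As A t s us)
  obtain C D where "\<forall>t. foldl App t us = plug C t" "\<forall>t. foldr Lam As t = plug D t"
    using foldl_App_plug foldr_Lam_plug by metis
  then show ?case unfolding red_beta_def
    using ctx_closure.intros[of "\<lambda>_. True" "plug_ctx D C" beta_root, OF _ beta_root.intros]
    by (simp add: plug_plug_ctx)
qed

theorem theorem20:
  "strongly_normalising red_a \<and>
   strongly_normalising red_lin \<and>
   strongly_normalising red_betad \<and>
   strongly_normalising red_beta \<and>
   strongly_normalising red_head \<and>
   strongly_normalising red_lin_head"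
proof -
  have lin: "decreases t u" if "red_lin t u" for t u
    using that unfolding red_lin_def by (rule decreases_ctx_closure) (rule decreases_lin_root)
  have gc: "decreases t u" if "red_gc t u" for t u
    using that unfolding red_gc_def by (rule decreases_ctx_closure) (rule decreases_gc_root)
  have betad: "decreases t u" if "red_betad t u" for t u
    using that unfolding red_betad_def by (rule decreases_ctx_closure) (rule decreases_betad_root)
  have beta: "decreases t u" if "red_beta t u" for t u
    using that unfolding red_beta_def
    by (rule decreases_ctx_closure) (intro decreases_betad_root beta_root_betad_root)
  \<comment> \<open>Both lemmas hold for every class of contexts, so they apply to H-contexts
    directly.\<close>
  have lin_head: "decreases t u" if "red_lin_head t u" for t u
    using that unfolding red_lin_head_def
    by (rule decreases_ctx_closure) (rule decreases_lin_root)
  show ?thesis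
    by (intro conjI decreases_strongly_normalising)
      (auto simp: red_a_def intro: lin gc betad beta lin_head red_head_red_beta)
qed

end
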